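(* Let $\lambda\in\mathbb{R}$, let $\boldsymbol{L}$ be the Laplace-like operator with diagonal factors $L_k=\operatorname{diag}(\lambda_{k,0},\ldots,\lambda_{k,n_k-1})$ on $\mathbb{R}^{n_1\times\cdots\times n_K}$ defined in the context, and let $\boldsymbol{x}\in\mathbb{R}^{n_1\times\cdots\times n_K}$, $\boldsymbol{x}\neq 0$, have a matrix product state representation $\boldsymbol{x}=\tau(\mathsf{X})$ with minimal ranks $\mathsf{r}=(r_1,\ldots,r_{K-1})$. Then $\boldsymbol{L}\boldsymbol{x}=\lambda\boldsymbol{x}$ holds if and only if the representation $\mathsf{X}=(X_1,\ldots,X_K)$ of $\boldsymbol{x}$ with ranks $\mathsf{r}$ can be chosen such that the following holds: for $k=1,\ldots,K$ and for all $\mu\in\mathcal{K}_{\lambda,k}$ there exist sets $\mathcal{S}_{k,\mu}\subseteq\{1,\ldots,r_k\}$ such that $$\boldsymbol{L}_k^{\leq}\,\tau^{\leq}_{k,j}(\mathsf{X})=\mu\,\tau^{\leq}_{k,j}(\mathsf{X}),\qquad \boldsymbol{L}_k^{>}\,\tau^{>}_{k,j}(\mathsf{X})=(\lambda-\mu)\,\tau^{>}_{k,j}(\mathsf{X}),\qquad j\in\mathcal{S}_{k,\mu},$$ and the matrices $X_k^{\{\beta\}}$, $\beta=0,1,\ldots,n_k-1$, have nonzero entries only in the blocks $$X_k^{\{\beta\}}\big|_{\mathcal{S}_{k-1,\mu}\times\mathcal{S}_{k,\mu+\lambda_{k,\beta}}}\qquad\text{for }\mu\in\mathcal{K}_{\lambda,k-1}\cap(\mathcal{K}_{\lambda,k}-\lambda_{k,\beta}),$$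 where we set $\mathcal{S}_{0,0}=\mathcal{S}_{K,\lambda}=\{1\}$.
   Context: Fix $K\in\mathbb{N}$ and $n_1,\ldots,n_K\in\mathbb{N}$. Tensors in $\mathbb{R}^{n_1\times\cdots\times n_K}$ are indexed by $\alpha\in\mathcal{N}=\{0,\ldots,n_1-1\}\times\cdots\times\{0,\ldots,n_K-1\}$ and identified with elements of $\mathbb{R}^{n_1}\otimes\cdots\otimes\mathbb{R}^{n_K}$. Laplace-like operator: for real numbers $\lambda_{k,\beta}$ ($k=1,\ldots,K$, $\beta=0,\ldots,n_k-1$) let $L_k=\operatorname{diag}(\lambda_{k,0},\ldots,\lambda_{k,n_k-1})$ and $$\boldsymbol{L}=\sum_{k=1}^K I^{\otimes(k-1)}\otimes L_k\otimes I^{\otimes(K-k)},$$ where each $I$ is the identity of the appropriate size. The truncated operators are $$\boldsymbol{L}_k^{\leq}=\sum_{i=1}^k I^{\otimes(i-1)}\otimes L_i\otimes I^{\otimes(k-i)},\qquad \boldsymbol{L}_k^{>}=\sum_{i=k+1}^K I^{\otimes(i-k-1)}\otimes L_i\otimes I^{\otimes(K-i)},$$ acting on $\mathbb{R}^{n_1\times\cdots\times n_k}$ and $\mathbb{R}^{n_{k+1}\times\cdots\times n_K}$, respectively (for $k=K$, $\boldsymbol{L}_K^{>}$ is the zero operator on $\mathbb{R}$). For $\lambda\in\mathbb{R}$, let $I_\lambda=\{\alpha\in\mathcal{N}:\sum_{k=1}^K\lambda_{k,\alpha_k}=\lambda\}$ and, for $k=1,\ldots,K$, $\mathcal{K}_{\lambda,k}=\{\sum_{\ell=1}^k\lambda_{\ell,\alpha_\ell}:\alpha\in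 I_\lambda\}$; moreover $\mathcal{K}_{\lambda,0}=\{0\}$. For $\mathcal{K}\subset\mathbb{R}$ and $c\in\mathbb{R}$, $\mathcal{K}-c=\{\mu\in\mathbb{R}:\mu+c\in\mathcal{K}\}$. Matrix product states (MPS): a representation with ranks $(r_1,\ldots,r_{K-1})$, $r_0=r_K=1$, is a tuple $\mathsf{X}=(X_1,\ldots,X_K)$ of cores $X_k=(X_k(j,\beta,j'))$ with $j=1,\ldots,r_{k-1}$, $\beta=0,\ldots,n_k-1$, $j'=1,\ldots,r_k$. Write $X_k^{\{\beta\}}=(X_k(j,\beta,j'))_{j,j'}\in\mathbb{R}^{r_{k-1}\times r_k}$. The represented tensor is $\tau(\mathsf{X})_\alpha=X_1^{\{\alpha_1\}}X_2^{\{\alpha_2\}}\cdots X_K^{\{\alpha_K\}}$. Partial representations are $$\tau^{\leq}_{k,j}(\mathsf{X})=\bigl((X_1^{\{\alpha_1\}}\cdots X_k^{\{\alpha_k\}})_{1,j}\bigr)_{\alpha_1,\ldots,\alpha_k},\qquad \tau^{>}_{k,j}(\mathsf{X})=\bigl((X_{k+1}^{\{\alpha_{k+1}\}}\cdots X_K^{\{\alpha_K\}})_{j,1}\bigr)_{\alpha_{k+1},\ldots,\alpha_K},$$ for $j=1,\ldots,r_k$ (with $\tau^{>}_{K,1}(\mathsf{X})=1$). Ranks are minimal if each $r_k$ is the smallest possible among all MPS representations of $\boldsymbol{x}$; equivalently, $r_k$ is the rank of the matricization of $\boldsymbol{x}$ with row index $(\alpha_1,\ldots,\alpha_k)$ and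 column index $(\alpha_{k+1},\ldots,\alpha_K)$. *)

theory Defs
  imports "Jordan_Normal_Form.Matrix" "HOL-Library.FuncSet"
begin

text \<open>
  A multi-index for a set \<open>M\<close> of modes is an extensional function on \<open>M\<close>, so that the truncated
  tensors keep the mode labels they have in the full tensor. A tensor over \<open>M\<close> is a real function
  on multi-indices of which only the values on \<open>multi_indices n M\<close> matter; tensors are therefore
  compared on that set. For \<open>M = {}\<close> there is exactly one multi-index, and tensors are scalars.
\<close>

type_synonym multi_index = "nat \<Rightarrow> nat"
type_synonym tensor = "multi_index \<Rightarrow> real"

definition multi_indices :: "(nat \<Rightarrow> nat) \<Rightarrow> nat set \<Rightarrow> multi_index set" where
  "multi_indices n M = (\<Pi>\<^sub>E k\<in>M. {..<n k})"

definition tensor_eq :: "(nat \<Rightarrow> nat) \<Rightarrow> nat set \<Rightarrow> tensor \<Rightarrow> tensor \<Rightarrow> bool" where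
  "tensor_eq n M x y \<longleftrightarrow> (\<forall>\<alpha>\<in>multi_indices n M. x \<alpha> = y \<alpha>)"

text \<open>The operator \<open>A\<^sub>1 \<otimes> \<dots> \<otimes> A\<^sub>m\<close> (Kronecker product), with one factor \<open>A i\<close> for each \<open>i \<in> M\<close>.\<close>

definition kron_op :: "(nat \<Rightarrow> nat) \<Rightarrow> nat set \<Rightarrow> (nat \<Rightarrow> real mat) \<Rightarrow> tensor \<Rightarrow> tensor" where
  "kron_op n M A x = (\<lambda>\<alpha>. \<Sum>\<beta>\<in>multi_indices n M. (\<Prod>i\<in>M. A i $$ (\<alpha> i, \<beta> i)) * x \<beta>)"

text \<open>
  The Laplace-like operator on the modes \<open>M\<close>, where \<open>ev k \<beta>\<close> is \<open>\<lambda>\<^bsub>k,\<beta>\<^esub>\<close>. The full operator and the two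
  truncated ones are the instances \<open>{1..K}\<close>, \<open>{1..k}\<close> and \<open>{k+1..K}\<close>.
\<close>

definition laplace_op :: "(nat \<Rightarrow> nat) \<Rightarrow> (nat \<Rightarrow> nat \<Rightarrow> real) \<Rightarrow> nat set \<Rightarrow> tensor \<Rightarrow> tensor" where
  "laplace_op n ev M x =
     (\<lambda>\<alpha>. \<Sum>k\<in>M. kron_op n M (\<lambda>i. if i = k then mat_diag (n k) (ev k) else 1\<^sub>m (n i)) x \<alpha>)"

definition eig_indices ::
  "(nat \<Rightarrow> nat) \<Rightarrow> nat \<Rightarrow> (nat \<Rightarrow> nat \<Rightarrow> real) \<Rightarrow> real \<Rightarrow> multi_index set" where
  "eig_indices n K ev lam = {\<alpha> \<in> multi_indices n {1..K}. (\<Sum>k=1..K. ev k (\<alpha> k)) = lam}"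

text \<open>The sets \<open>\<K>\<^bsub>\<lambda>,k\<^esub>\<close>; for \<open>k = 0\<close> the value is \<open>{0}\<close> even if \<open>eig_indices\<close> is empty.\<close>

definition partial_eigs ::
  "(nat \<Rightarrow> nat) \<Rightarrow> nat \<Rightarrow> (nat \<Rightarrow> nat \<Rightarrow> real) \<Rightarrow> real \<Rightarrow> nat \<Rightarrow> real set" where
  "partial_eigs n K ev lam k =
     (if k = 0 then {0} else {\<Sum>l=1..k. ev l (\<alpha> l) |\<alpha>. \<alpha> \<in> eig_indices n K ev lam})"

definition set_shift :: "real set \<Rightarrow> real \<Rightarrow> real set" where
  "set_shift A c = {\<mu>. \<mu> + c \<in> A}"

text \<open>
  The cores are given by their slices: \<open>X k \<beta>\<close> is the matrix \<open>X\<^sub>k\<^bsup>{\<beta>}\<^esup>\<close>. Modes are numbered from 1,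
  but rank indices from 0, as rows and columns are in \<open>Jordan_Normal_Form.Matrix\<close>; the rank index
  \<open>1\<close> of the mathematical notation is thus \<open>0\<close> here.
\<close>

type_synonym cores = "nat \<Rightarrow> nat \<Rightarrow> real mat"

definition is_mps :: "(nat \<Rightarrow> nat) \<Rightarrow> nat \<Rightarrow> (nat \<Rightarrow> nat) \<Rightarrow> cores \<Rightarrow> bool" where
  "is_mps n K r X \<longleftrightarrow> r 0 = 1 \<and> r K = 1 \<and>
     (\<forall>k\<in>{1..K}. \<forall>\<beta><n k. X k \<beta> \<in> carrier_mat (r (k - 1)) (r k))"

text \<open>The product of the slices of the modes \<open>a + 1, \<dots>, b\<close> selected by \<open>\<alpha>\<close>.\<close>

definition core_prod :: "(nat \<Rightarrow> nat) \<Rightarrow> cores \<Rightarrow> nat \<Rightarrow> nat \<Rightarrow> multi_index \<Rightarrow> real mat" where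
  "core_prod r X a b \<alpha> = foldl (\<lambda>P k. P * X k (\<alpha> k)) (1\<^sub>m (r a)) [Suc a..<Suc b]"

definition mps_tensor :: "nat \<Rightarrow> (nat \<Rightarrow> nat) \<Rightarrow> cores \<Rightarrow> tensor" where
  "mps_tensor K r X = (\<lambda>\<alpha>. core_prod r X 0 K \<alpha> $$ (0, 0))"

definition mps_left :: "(nat \<Rightarrow> nat) \<Rightarrow> cores \<Rightarrow> nat \<Rightarrow> nat \<Rightarrow> tensor" where
  "mps_left r X k j = (\<lambda>\<alpha>. core_prod r X 0 k \<alpha> $$ (0, j))"

definition mps_right :: "nat \<Rightarrow> (nat \<Rightarrow> nat) \<Rightarrow> cores \<Rightarrow> nat \<Rightarrow> nat \<Rightarrow> tensor" where
  "mps_right K r X k j = (\<lambda>\<alpha>. core_prod r X k K \<alpha> $$ (j, 0))"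

definition mps_represents ::
  "(nat \<Rightarrow> nat) \<Rightarrow> nat \<Rightarrow> (nat \<Rightarrow> nat) \<Rightarrow> cores \<Rightarrow> tensor \<Rightarrow> bool" where
  "mps_represents n K r X x \<longleftrightarrow> is_mps n K r X \<and> tensor_eq n {1..K} x (mps_tensor K r X)"

definition mps_ranks_minimal :: "(nat \<Rightarrow> nat) \<Rightarrow> nat \<Rightarrow> (nat \<Rightarrow> nat) \<Rightarrow> tensor \<Rightarrow> bool" where
  "mps_ranks_minimal n K r x \<longleftrightarrow>
     (\<forall>r' X'. mps_represents n K r' X' x \<longrightarrow> (\<forall>k\<in>{1..<K}. r k \<le> r' k))"

end

theory Submission
  imports Defs "HOL-Library.Function_Algebras"
begin

text \<open>
  The operator is diagonal: it multiplies the entry at \<open>\<alpha>\<close> by the weight \<open>\<Sum>k. ev k (\<alpha> k)\<close>. Hence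
  \<open>x\<close> is an eigentensor for \<open>lam\<close> iff it vanishes at all \<open>\<alpha>\<close> of weight other than \<open>lam\<close>.

  Suppose that \<open>x\<close> has this property. Freezing the indices after \<open>k\<close> at the values of some
  \<open>\<gamma>\<close> turns \<open>x\<close> into a tensor in the first \<open>k\<close> indices, a column of the \<open>k\<close>-th matricization. Each
  column is homogeneous: its support lies in a single partial weight, namely \<open>lam\<close> minus the
  weight of the frozen part (\<open>column_weight\<close>). The given representation shows that the columns
  span a space of dimension at most \<open>r k\<close> (\<open>column_in_left_span\<close>), so some \<open>r k\<close> \<^emph>\<open>columns\<close> span
  all of them (\<open>spanning_subfamily\<close>), and these are homogeneous. Fix the last index of a
  \<open>k\<close>-column: what remains is a \<open>(k-1)\<close>-column, hence a combination of the spanning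
  \<open>(k-1)\<close>-columns. The coefficients are the entries of the new core \<open>Y k\<close>; those between
  incompatible weights cancel and are set to zero. The new cores thus have the required block
  structure, and the left partial products reproduce the chosen columns, which at \<open>k = K\<close> means
  that \<open>Y\<close> represents \<open>x\<close> (\<open>homogeneous_cores\<close>).

  Block structure alone makes all partial products homogeneous (\<open>core_prod_weight\<close>), because the
  weights add up along the product; this gives the eigenvalue equations for the left and right
  parts at once. Conversely, the equation for the left part at \<open>k = K\<close> is the equation for
  \<open>x\<close> itself, provided that \<open>lam\<close> occurs as a weight; otherwise no block of the last core is
  admissible, so this core, and with it \<open>x\<close>, would vanish.
\<close>

section \<open>The Laplace-like operator is diagonal\<close>

lemma finite_multi_indices: "finite M \<Longrightarrow> finite (multi_indices n M)"
  unfolding multi_indices_def by (rule finite_PiE) auto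

lemma multi_index_less: "\<alpha> \<in> multi_indices n M \<Longrightarrow> i \<in> M \<Longrightarrow> \<alpha> i < n i"
  unfolding multi_indices_def by (metis PiE_mem lessThan_iff)

lemma laplace_op_diagonal:
  assumes M: "finite M" and \<alpha>: "\<alpha> \<in> multi_indices n M"
  shows "laplace_op n ev M x \<alpha> = (\<Sum>k\<in>M. ev k (\<alpha> k)) * x \<alpha>"
proof -
  have "kron_op n M (\<lambda>i. if i = k then mat_diag (n k) (ev k) else 1\<^sub>m (n i)) x \<alpha> = ev k (\<alpha> k) * x \<alpha>"
    if k: "k \<in> M" for k
  proof -
    let ?A = "\<lambda>i. if i = k then mat_diag (n k) (ev k) else 1\<^sub>m (n i)"
    have off: "(\<Prod>i\<in>M. ?A i $$ (\<alpha> i, \<beta> i)) = 0"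
      if \<beta>: "\<beta> \<in> multi_indices n M" "\<beta> \<noteq> \<alpha>" for \<beta>
    proof -
      obtain i where i: "i \<in> M" "\<alpha> i \<noteq> \<beta> i"
        using \<alpha> \<beta> unfolding multi_indices_def by (metis PiE_ext)
      have "?A i $$ (\<alpha> i, \<beta> i) = 0"
        using i multi_index_less[OF \<alpha> i(1)] multi_index_less[OF \<beta>(1) i(1)] by (auto simp: mat_diag_def)
      with i(1) show ?thesis by (intro prod_zero[OF M] bexI)
    qed
    have "(\<Prod>i\<in>M. ?A i $$ (\<alpha> i, \<alpha> i)) = (\<Prod>i\<in>M. if i = k then ev k (\<alpha> k) else 1)"
      using multi_index_less[OF \<alpha>] by (intro prod.cong refl) (auto simp: mat_diag_def)
    also have "\<dots> = ev k (\<alpha> k)" using M k by (simp add: prod.delta)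
    finally have diag: "(\<Prod>i\<in>M. ?A i $$ (\<alpha> i, \<alpha> i)) = ev k (\<alpha> k)" .
    have "kron_op n M ?A x \<alpha> = (\<Sum>\<beta>\<in>{\<alpha>}. (\<Prod>i\<in>M. ?A i $$ (\<alpha> i, \<beta> i)) * x \<beta>)"
      unfolding kron_op_def
      using \<alpha> off finite_multi_indices[OF M] by (intro sum.mono_neutral_right) auto
    then show ?thesis using diag by simp
  qed
  then show ?thesis unfolding laplace_op_def by (simp add: sum_distrib_right)
qed

lemma laplace_eigen_iff_support:
  assumes "finite M"
  shows "tensor_eq n M (laplace_op n ev M x) (\<lambda>\<alpha>. \<mu> * x \<alpha>) \<longleftrightarrow>
    (\<forall>\<alpha>\<in>multi_indices n M. x \<alpha> \<noteq> 0 \<longrightarrow> (\<Sum>k\<in>M. ev k (\<alpha> k)) = \<mu>)"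
  unfolding tensor_eq_def using laplace_op_diagonal[OF assms] by auto

section \<open>Products of cores\<close>

lemma core_prod_refl: "core_prod r X a a \<alpha> = 1\<^sub>m (r a)"
  unfolding core_prod_def by simp

lemma core_prod_Suc:
  "a \<le> b \<Longrightarrow> core_prod r X a (Suc b) \<alpha> = core_prod r X a b \<alpha> * X (Suc b) (\<alpha> (Suc b))"
  unfolding core_prod_def by simp

lemma core_prod_cong:
  assumes "a \<le> b" "\<And>l. l \<in> {Suc a..b} \<Longrightarrow> \<alpha> l = \<beta> l"
  shows "core_prod r X a b \<alpha> = core_prod r X a b \<beta>"
  using assms by (induction b rule: dec_induct) (auto simp: core_prod_refl core_prod_Suc)

lemma core_carrier:
  assumes "is_mps n K r X" "Suc k \<le> K" "\<beta> < n (Suc k)"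
  shows "X (Suc k) \<beta> \<in> carrier_mat (r k) (r (Suc k))"
proof -
  have "\<forall>\<beta><n (Suc k). X (Suc k) \<beta> \<in> carrier_mat (r (Suc k - 1)) (r (Suc k))"
    using assms(1,2) unfolding is_mps_def by (elim conjE) (erule bspec, simp)
  then show ?thesis using assms(3) by simp
qed

lemma core_prod_carrier:
  assumes "is_mps n K r X" "a \<le> b" "b \<le> K" "\<And>l. l \<in> {Suc a..b} \<Longrightarrow> \<alpha> l < n l"
  shows "core_prod r X a b \<alpha> \<in> carrier_mat (r a) (r b)"
  using assms(2-)
proof (induction b rule: dec_induct)
  case base
  then show ?case by (simp add: core_prod_refl)
next
  case (step b)
  have "core_prod r X a b \<alpha> \<in> carrier_mat (r a) (r b)" using step by simp
  moreover have "X (Suc b) (\<alpha> (Suc b)) \<in> carrier_mat (r b) (r (Suc b))"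
    using core_carrier[OF assms(1)] step by simp
  ultimately show ?case using step by (simp add: core_prod_Suc)
qed

lemma mat_mult_entry:
  assumes "A \<in> carrier_mat p q" "B \<in> carrier_mat q s" "i < p" "j < s"
  shows "(A * B) $$ (i, j) = (\<Sum>l<q. A $$ (i, l) * B $$ (l, j))"
  using assms by (auto simp: scalar_prod_def lessThan_atLeast0 intro!: sum.cong)

lemma core_prod_split:
  assumes "is_mps n K r X" "a \<le> b" "b \<le> c" "c \<le> K" "\<And>l. l \<in> {Suc a..c} \<Longrightarrow> \<alpha> l < n l"
  shows "core_prod r X a c \<alpha> = core_prod r X a b \<alpha> * core_prod r X b c \<alpha>"
  using assms(3-)
proof (induction c rule: dec_induct)
  case base
  have "core_prod r X a b \<alpha> \<in> carrier_mat (r a) (r b)"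
    using core_prod_carrier[OF assms(1,2), of \<alpha>] base by simp
  then show ?case by (simp add: core_prod_refl)
next
  case (step c)
  have "core_prod r X a b \<alpha> \<in> carrier_mat (r a) (r b)"
    using core_prod_carrier[OF assms(1,2), of \<alpha>] step by simp
  moreover have "core_prod r X b c \<alpha> \<in> carrier_mat (r b) (r c)"
    using core_prod_carrier[OF assms(1), of b c \<alpha>] step assms(2) by simp
  moreover have "X (Suc c) (\<alpha> (Suc c)) \<in> carrier_mat (r c) (r (Suc c))"
    using core_carrier[OF assms(1)] step assms(2) by simp
  ultimately show ?case using step assms(2) by (simp add: core_prod_Suc)
qed

text \<open>
  Here \<open>w k j\<close> is the weight of the \<open>j\<close>-th rank index between the modes \<open>k\<close> and \<open>Suc k\<close>.
\<close>

definition weight_compatible ::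
  "(nat \<Rightarrow> nat) \<Rightarrow> nat \<Rightarrow> (nat \<Rightarrow> nat) \<Rightarrow> (nat \<Rightarrow> nat \<Rightarrow> real) \<Rightarrow> (nat \<Rightarrow> nat \<Rightarrow> real) \<Rightarrow> cores \<Rightarrow> bool"
where
  "weight_compatible n K r ev w X \<longleftrightarrow> (\<forall>k \<beta> i j. Suc k \<le> K \<longrightarrow> \<beta> < n (Suc k) \<longrightarrow> i < r k \<longrightarrow>
     j < r (Suc k) \<longrightarrow> X (Suc k) \<beta> $$ (i, j) \<noteq> 0 \<longrightarrow> w k i + ev (Suc k) \<beta> = w (Suc k) j)"

lemma weight_compatibleD:
  assumes "weight_compatible n K r ev w X" "Suc k \<le> K" "\<beta> < n (Suc k)" "i < r k" "j < r (Suc k)"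
    and "X (Suc k) \<beta> $$ (i, j) \<noteq> 0"
  shows "w k i + ev (Suc k) \<beta> = w (Suc k) j"
  using assms unfolding weight_compatible_def by simp

text \<open>
  If each core only connects rank indices whose weights differ by the eigenvalue of the mode it
  reads, then along a nonzero path of rank indices these differences add up.
\<close>

lemma core_prod_weight:
  assumes mps: "is_mps n K r X"
    and block: "weight_compatible n K r ev w X"
    and "a \<le> b" "b \<le> K" "\<And>l. l \<in> {Suc a..b} \<Longrightarrow> \<alpha> l < n l"
    and "i < r a" "j < r b" "core_prod r X a b \<alpha> $$ (i, j) \<noteq> 0"
  shows "w a i + (\<Sum>l=Suc a..b. ev l (\<alpha> l)) = (w b j :: real)"
  using assms(3-)
proof (induction b arbitrary: j rule: dec_induct)
  case base
  then show ?case by (auto simp: core_prod_refl split: if_splits)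
next
  case (step b)
  have C: "core_prod r X a b \<alpha> \<in> carrier_mat (r a) (r b)"
    using core_prod_carrier[OF mps, of a b \<alpha>] step by simp
  have D: "X (Suc b) (\<alpha> (Suc b)) \<in> carrier_mat (r b) (r (Suc b))"
    using core_carrier[OF mps] step by simp
  have "(\<Sum>l<r b. core_prod r X a b \<alpha> $$ (i, l) * X (Suc b) (\<alpha> (Suc b)) $$ (l, j)) \<noteq> 0"
    using step mat_mult_entry[OF C D] by (simp add: core_prod_Suc)
  then obtain l where l: "l < r b" "core_prod r X a b \<alpha> $$ (i, l) \<noteq> 0"
    "X (Suc b) (\<alpha> (Suc b)) $$ (l, j) \<noteq> 0"
    by (metis (no_types, lifting) lessThan_iff mult_eq_0_iff sum.neutral)
  have "w a i + (\<Sum>l=Suc a..b. ev l (\<alpha> l)) = w b l" using step l by simp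
  moreover have "w b l + ev (Suc b) (\<alpha> (Suc b)) = w (Suc b) j"
    using weight_compatibleD[OF block] step l by simp
  ultimately show ?case using step by simp
qed

section \<open>Columns of the matricizations\<close>

text \<open>
  The columns of the \<open>k\<close>-th matricization are the functions \<open>\<lambda>\<alpha>. x (glue k \<alpha> \<gamma>)\<close>. Both \<open>\<alpha>\<close> and
  \<open>\<gamma>\<close> range over full multi-indices, so that the columns for different \<open>k\<close> live on the same set.
\<close>

definition glue :: "nat \<Rightarrow> multi_index \<Rightarrow> multi_index \<Rightarrow> multi_index" where
  "glue k \<alpha> \<gamma> = (\<lambda>i. if i \<le> k then \<alpha> i else \<gamma> i)"

lemma glue_in:
  "\<alpha> \<in> multi_indices n {1..K} \<Longrightarrow> \<gamma> \<in> multi_indices n {1..K} \<Longrightarrow> glue k \<alpha> \<gamma> \<in> multi_indices n {1..K}"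
  unfolding multi_indices_def glue_def PiE_iff extensional_def by auto

lemma glue_0:
  "\<alpha> \<in> multi_indices n {1..K} \<Longrightarrow> \<gamma> \<in> multi_indices n {1..K} \<Longrightarrow> glue 0 \<alpha> \<gamma> = \<gamma>"
  unfolding multi_indices_def glue_def PiE_iff extensional_def by fastforce

lemma glue_K:
  "\<alpha> \<in> multi_indices n {1..K} \<Longrightarrow> \<gamma> \<in> multi_indices n {1..K} \<Longrightarrow> glue K \<alpha> \<gamma> = \<alpha>"
  unfolding multi_indices_def glue_def PiE_iff extensional_def by fastforce

lemma sum_glue:
  fixes ev :: "nat \<Rightarrow> nat \<Rightarrow> real"
  assumes "k \<le> K"
  shows "(\<Sum>l=1..K. ev l (glue k \<alpha> \<gamma> l)) = (\<Sum>l=1..k. ev l (\<alpha> l)) + (\<Sum>l=Suc k..K. ev l (\<gamma> l))"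
proof -
  have "{1..K} = {1..k} \<union> {Suc k..K}" using assms by auto
  then have "(\<Sum>l=1..K. ev l (glue k \<alpha> \<gamma> l)) =
    (\<Sum>l=1..k. ev l (glue k \<alpha> \<gamma> l)) + (\<Sum>l=Suc k..K. ev l (glue k \<alpha> \<gamma> l))"
    by (simp add: sum.union_disjoint)
  then show ?thesis by (simp add: glue_def)
qed

lemma partial_eigs_member:
  assumes "\<alpha> \<in> eig_indices n K ev lam"
  shows "(\<Sum>l=1..k. ev l (\<alpha> l)) \<in> partial_eigs n K ev lam k"
  using assms unfolding partial_eigs_def by auto

text \<open>
  Homogeneity of the columns: the total weight on the support is \<open>lam\<close>, and the frozen indices
  contribute a fixed amount to it. The tensor \<open>x\<close> is nonzero so that a zero column, too, can be
  given an admissible weight.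
\<close>

lemma column_weight:
  assumes supp: "\<forall>\<alpha>\<in>multi_indices n {1..K}. x \<alpha> \<noteq> 0 \<longrightarrow> (\<Sum>l=1..K. ev l (\<alpha> l)) = lam"
    and nz: "\<alpha>0 \<in> multi_indices n {1..K}" "x \<alpha>0 \<noteq> 0"
    and k: "k \<le> K" and \<gamma>: "\<gamma> \<in> multi_indices n {1..K}"
  shows "\<exists>\<mu>\<in>partial_eigs n K ev lam k. \<forall>\<alpha>\<in>multi_indices n {1..K}.
    x (glue k \<alpha> \<gamma>) \<noteq> 0 \<longrightarrow> (\<Sum>l=1..k. ev l (\<alpha> l)) = \<mu>"
proof (cases "\<exists>\<alpha>\<in>multi_indices n {1..K}. x (glue k \<alpha> \<gamma>) \<noteq> 0")
  case True
  let ?\<mu> = "lam - (\<Sum>l=Suc k..K. ev l (\<gamma> l))"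
  have weight: "(\<Sum>l=1..k. ev l (\<alpha> l)) = ?\<mu>"
    if "\<alpha> \<in> multi_indices n {1..K}" "x (glue k \<alpha> \<gamma>) \<noteq> 0" for \<alpha>
    using supp glue_in[OF that(1) \<gamma>] that(2) sum_glue[OF k, of ev \<alpha> \<gamma>] by fastforce
  obtain \<alpha> where \<alpha>: "\<alpha> \<in> multi_indices n {1..K}" "x (glue k \<alpha> \<gamma>) \<noteq> 0" using True by blast
  have "glue k \<alpha> \<gamma> \<in> eig_indices n K ev lam"
    unfolding eig_indices_def using glue_in[OF \<alpha>(1) \<gamma>] supp \<alpha>(2) by simp
  then have "(\<Sum>l=1..k. ev l (glue k \<alpha> \<gamma> l)) \<in> partial_eigs n K ev lam k"
    by (rule partial_eigs_member)
  then have "?\<mu> \<in> partial_eigs n K ev lam k" using weight[OF \<alpha>] by (simp add: glue_def)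
  then show ?thesis using weight by blast
next
  case False
  have "\<alpha>0 \<in> eig_indices n K ev lam" unfolding eig_indices_def using nz supp by simp
  then show ?thesis using partial_eigs_member False by blast
qed

lemma column_in_left_span:
  assumes rep: "mps_represents n K r X x" and k: "k \<le> K"
    and \<gamma>: "\<gamma> \<in> multi_indices n {1..K}" and \<alpha>: "\<alpha> \<in> multi_indices n {1..K}"
  shows "x (glue k \<alpha> \<gamma>) = (\<Sum>j<r k. core_prod r X k K \<gamma> $$ (j, 0) * mps_left r X k j \<alpha>)"
proof -
  let ?g = "glue k \<alpha> \<gamma>"
  have mps: "is_mps n K r X" and r: "r 0 = 1" "r K = 1"
    using rep unfolding mps_represents_def is_mps_def by auto
  have g: "?g \<in> multi_indices n {1..K}" by (rule glue_in[OF \<alpha> \<gamma>])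
  have lt: "\<delta> l < n l" if "\<delta> \<in> multi_indices n {1..K}" "1 \<le> l" "l \<le> K" for \<delta> l
    using multi_index_less[OF that(1)] that by simp
  have C: "core_prod r X 0 k \<alpha> \<in> carrier_mat 1 (r k)"
    using core_prod_carrier[OF mps, of 0 k \<alpha>] lt[OF \<alpha>] k r by simp
  have D: "core_prod r X k K \<gamma> \<in> carrier_mat (r k) 1"
    using core_prod_carrier[OF mps, of k K \<gamma>] lt[OF \<gamma>] k r by simp
  have "x ?g = core_prod r X 0 K ?g $$ (0, 0)"
    using rep g unfolding mps_represents_def tensor_eq_def mps_tensor_def by simp
  also have "core_prod r X 0 K ?g = core_prod r X 0 k ?g * core_prod r X k K ?g"
    using core_prod_split[OF mps, of 0 k K ?g] lt[OF g] k by simp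
  also have "core_prod r X 0 k ?g = core_prod r X 0 k \<alpha>"
    by (rule core_prod_cong) (auto simp: glue_def)
  also have "core_prod r X k K ?g = core_prod r X k K \<gamma>"
    by (rule core_prod_cong[OF k]) (auto simp: glue_def)
  finally show ?thesis
    using mat_mult_entry[OF C D] unfolding mps_left_def by (simp add: mult.commute)
qed

text \<open>
  A family in the span of \<open>r\<close> functions is spanned by \<open>r\<close> of its own members: a maximal independent
  subfamily has at most \<open>r\<close> elements, and repetitions with coefficient zero fill up the rest.
\<close>

lemma spanning_subfamily:
  fixes f :: "'i \<Rightarrow> 'a \<Rightarrow> real" and g :: "nat \<Rightarrow> 'a \<Rightarrow> real" and r :: nat
  assumes comb: "\<And>i a. i \<in> I \<Longrightarrow> a \<in> A \<Longrightarrow> f i a = (\<Sum>j<r. c i j * g j a)" and "I \<noteq> {}"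
  shows "\<exists>p. (\<forall>j. p j \<in> I) \<and> (\<forall>i\<in>I. \<exists>d. \<forall>a\<in>A. f i a = (\<Sum>j<r. d j * f (p j) a))"
proof -
  interpret vs: vector_space "\<lambda>c (h :: 'a \<Rightarrow> real) a. c * h a"
    by unfold_locales (auto simp: algebra_simps fun_eq_iff)
  have eval_sum: "(\<Sum>s\<in>T. h s) a = (\<Sum>s\<in>T. h s a)" for T and h :: "'b \<Rightarrow> 'a \<Rightarrow> real" and a
    by (induction T rule: infinite_finite_induct) auto
  \<comment> \<open>Only the values on \<open>A\<close> matter, so the functions are cut off outside \<open>A\<close>.\<close>
  define F where "F i = (\<lambda>a. if a \<in> A then f i a else 0)" for i
  define G where "G j = (\<lambda>a. if a \<in> A then g j a else 0)" for j
  obtain B where B: "B \<subseteq> F ` I" "vs.independent B" "F ` I \<subseteq> vs.span B"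
    by (rule vs.maximal_independent_subset)
  have "F i \<in> vs.span (G ` {..<r})" if "i \<in> I" for i
  proof -
    have "F i = (\<Sum>j<r. (\<lambda>a. c i j * G j a))"
      using comb[OF that] by (auto simp: fun_eq_iff eval_sum F_def G_def)
    also have "\<dots> \<in> vs.span (G ` {..<r})"
      by (intro vs.span_sum vs.span_scale vs.span_base) auto
    finally show ?thesis .
  qed
  then have "B \<subseteq> vs.span (G ` {..<r})" using B(1) by auto
  then have fin: "finite B" and "card B \<le> card (G ` {..<r})"
    using vs.independent_span_bound[OF _ B(2)] by auto
  then have card: "card B \<le> r" using card_image_le[of "{..<r}" G] by simp
  obtain e where e: "bij_betw e {..<card B} B"
    using fin ex_bij_betw_nat_finite lessThan_atLeast0 by metis
  obtain i0 where "i0 \<in> I" using \<open>I \<noteq> {}\<close> by blast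
  have "\<exists>i\<in>I. j < card B \<longrightarrow> F i = e j" for j
    using bij_betwE[OF e] B(1) \<open>i0 \<in> I\<close> by (cases "j < card B") fastforce+
  then obtain p where p: "\<And>j. p j \<in> I" "\<And>j. j < card B \<Longrightarrow> F (p j) = e j" by metis
  have "\<exists>d. \<forall>a\<in>A. f i a = (\<Sum>j<r. d j * f (p j) a)" if i: "i \<in> I" for i
  proof -
    obtain u where u: "F i = (\<Sum>v\<in>B. (\<lambda>a. u v * v a))"
      using subsetD[OF B(3) imageI[OF i]] unfolding vs.span_finite[OF fin] by (elim rangeE)
    have "f i a = (\<Sum>j<r. (if j < card B then u (e j) else 0) * f (p j) a)" if "a \<in> A" for a
    proof -
      have "f i a = (\<Sum>v\<in>B. u v * v a)" using fun_cong[OF u, of a] that by (simp add: F_def eval_sum)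
      also have "\<dots> = (\<Sum>j<card B. u (e j) * e j a)"
        by (rule sum.reindex_bij_betw[OF e, symmetric])
      also have "\<dots> = (\<Sum>j<card B. (if j < card B then u (e j) else 0) * f (p j) a)"
      proof (intro sum.cong refl)
        fix j assume "j \<in> {..<card B}"
        then show "u (e j) * e j a = (if j < card B then u (e j) else 0) * f (p j) a"
          using fun_cong[OF p(2), of j a] that by (simp add: F_def)
      qed
      also have "\<dots> = (\<Sum>j<r. (if j < card B then u (e j) else 0) * f (p j) a)"
        using card by (intro sum.mono_neutral_left) auto
      finally show ?thesis .
    qed
    then show ?thesis by (intro exI[of _ "\<lambda>j. if j < card B then u (e j) else 0"] ballI)
  qed
  then show ?thesis using p(1) by (intro exI[of _ p] conjI allI ballI)
qed

section \<open>Cores adapted to the weights\<close>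

text \<open>
  At the two ends the spanning family is prescribed: the empty left product is \<open>1\<close> and the
  full one has to be \<open>x\<close>. The factor \<open>s\<close> is there for the left end, where the columns are the scalars
  \<open>x \<gamma>\<close>, and \<open>1\<close> is a multiple of one that does not vanish.
\<close>

definition homogeneous_spanning ::
  "(nat \<Rightarrow> nat) \<Rightarrow> nat \<Rightarrow> (nat \<Rightarrow> nat) \<Rightarrow> (nat \<Rightarrow> nat \<Rightarrow> real) \<Rightarrow> real \<Rightarrow> tensor \<Rightarrow>
    nat \<Rightarrow> (nat \<Rightarrow> tensor) \<Rightarrow> (nat \<Rightarrow> real) \<Rightarrow> bool"
where
  "homogeneous_spanning n K r ev lam x k b w \<longleftrightarrow>
    (\<forall>j<r k. w j \<in> partial_eigs n K ev lam k \<and>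
      (\<forall>\<alpha>\<in>multi_indices n {1..K}. b j \<alpha> \<noteq> 0 \<longrightarrow> (\<Sum>l=1..k. ev l (\<alpha> l)) = w j) \<and>
      (\<exists>s. \<exists>\<gamma>\<in>multi_indices n {1..K}. \<forall>\<alpha>\<in>multi_indices n {1..K}. b j \<alpha> = s * x (glue k \<alpha> \<gamma>))) \<and>
    (\<forall>\<gamma>\<in>multi_indices n {1..K}. \<exists>c. \<forall>\<alpha>\<in>multi_indices n {1..K}.
      x (glue k \<alpha> \<gamma>) = (\<Sum>j<r k. c j * b j \<alpha>)) \<and>
    (k = 0 \<longrightarrow> b 0 = (\<lambda>_. 1) \<and> w 0 = 0) \<and> (k = K \<longrightarrow> b 0 = x \<and> w 0 = lam)"

lemma homogeneous_spanning_exists: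
  assumes supp: "\<forall>\<alpha>\<in>multi_indices n {1..K}. x \<alpha> \<noteq> 0 \<longrightarrow> (\<Sum>l=1..K. ev l (\<alpha> l)) = lam"
    and nz: "\<alpha>0 \<in> multi_indices n {1..K}" "x \<alpha>0 \<noteq> 0"
    and rep: "mps_represents n K r X x" and K: "1 \<le> K" and k: "k \<le> K"
  shows "\<exists>b w. homogeneous_spanning n K r ev lam x k b w"
proof -
  let ?N = "multi_indices n {1..K}"
  have r: "r 0 = 1" "r K = 1" using rep unfolding mps_represents_def is_mps_def by auto
  consider "k = 0" | "k = K" "k \<noteq> 0" | "k \<noteq> 0" "k \<noteq> K" by blast
  then show ?thesis
  proof cases
    case 1
    have "\<forall>\<alpha>\<in>?N. 1 = inverse (x \<alpha>0) * x (glue 0 \<alpha> \<alpha>0)" using nz by (simp add: glue_0)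
    then have "\<exists>s. \<exists>\<gamma>\<in>?N. \<forall>\<alpha>\<in>?N. 1 = s * x (glue 0 \<alpha> \<gamma>)" using nz(1) by blast
    moreover have "\<forall>\<gamma>\<in>?N. \<exists>c. \<forall>\<alpha>\<in>?N. x (glue 0 \<alpha> \<gamma>) = (\<Sum>j<r 0. c j * 1)"
    proof
      fix \<gamma> assume "\<gamma> \<in> ?N"
      then show "\<exists>c. \<forall>\<alpha>\<in>?N. x (glue 0 \<alpha> \<gamma>) = (\<Sum>j<r 0. c j * 1)"
        using r by (intro exI[of _ "\<lambda>_. x \<gamma>"]) (simp add: glue_0)
    qed
    ultimately show ?thesis
      unfolding homogeneous_spanning_def using 1 K r
      by (intro exI[of _ "\<lambda>_ _. 1"] exI[of _ "\<lambda>_. 0"]) (simp add: partial_eigs_def)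
  next
    case 2
    have "\<alpha>0 \<in> eig_indices n K ev lam" unfolding eig_indices_def using nz supp by simp
    then have "lam \<in> partial_eigs n K ev lam K"
      using partial_eigs_member[of \<alpha>0 n K ev lam K] supp nz by simp
    moreover have "\<forall>\<alpha>\<in>?N. x \<alpha> = 1 * x (glue K \<alpha> \<alpha>0)" using nz by (simp add: glue_K)
    then have "\<exists>s. \<exists>\<gamma>\<in>?N. \<forall>\<alpha>\<in>?N. x \<alpha> = s * x (glue K \<alpha> \<gamma>)" using nz(1) by blast
    moreover have "\<forall>\<gamma>\<in>?N. \<exists>c. \<forall>\<alpha>\<in>?N. x (glue K \<alpha> \<gamma>) = (\<Sum>j<r K. c j * x \<alpha>)"
    proof
      fix \<gamma> assume "\<gamma> \<in> ?N"
      then show "\<exists>c. \<forall>\<alpha>\<in>?N. x (glue K \<alpha> \<gamma>) = (\<Sum>j<r K. c j * x \<alpha>)"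
        using r by (intro exI[of _ "\<lambda>_. 1"]) (simp add: glue_K)
    qed
    ultimately show ?thesis
      unfolding homogeneous_spanning_def using 2 r supp
      by (intro exI[of _ "\<lambda>_. x"] exI[of _ "\<lambda>_. lam"]) simp
  next
    case 3
    have "\<exists>p. (\<forall>j. p j \<in> ?N) \<and>
      (\<forall>\<gamma>\<in>?N. \<exists>d. \<forall>\<alpha>\<in>?N. x (glue k \<alpha> \<gamma>) = (\<Sum>j<r k. d j * x (glue k \<alpha> (p j))))"
      by (rule spanning_subfamily[where f = "\<lambda>\<gamma> \<alpha>. x (glue k \<alpha> \<gamma>)"])
        (use column_in_left_span[OF rep k] nz(1) in auto)
    then obtain p where p: "\<And>j. p j \<in> ?N"
      "\<forall>\<gamma>\<in>?N. \<exists>d. \<forall>\<alpha>\<in>?N. x (glue k \<alpha> \<gamma>) = (\<Sum>j<r k. d j * x (glue k \<alpha> (p j)))"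
      by blast
    have "\<exists>\<mu>\<in>partial_eigs n K ev lam k. \<forall>\<alpha>\<in>?N.
        x (glue k \<alpha> (p j)) \<noteq> 0 \<longrightarrow> (\<Sum>l=1..k. ev l (\<alpha> l)) = \<mu>" for j
      by (rule column_weight[OF supp nz k p(1)])
    then obtain w where w: "\<And>j. w j \<in> partial_eigs n K ev lam k"
      "\<And>j. \<forall>\<alpha>\<in>?N. x (glue k \<alpha> (p j)) \<noteq> 0 \<longrightarrow> (\<Sum>l=1..k. ev l (\<alpha> l)) = w j"
      by metis
    have "\<exists>s. \<exists>\<gamma>\<in>?N. \<forall>\<alpha>\<in>?N. x (glue k \<alpha> (p j)) = s * x (glue k \<alpha> \<gamma>)" for j
      using p(1) by (intro exI[of _ 1] bexI[of _ "p j"]) auto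
    then show ?thesis
      unfolding homogeneous_spanning_def using 3 p(2) w
      by (intro exI[of _ "\<lambda>j \<alpha>. x (glue k \<alpha> (p j))"] exI[of _ w]) auto
  qed
qed

lemma homogeneous_cores:
  assumes supp: "\<forall>\<alpha>\<in>multi_indices n {1..K}. x \<alpha> \<noteq> 0 \<longrightarrow> (\<Sum>l=1..K. ev l (\<alpha> l)) = lam"
    and nz: "\<alpha>0 \<in> multi_indices n {1..K}" "x \<alpha>0 \<noteq> 0"
    and rep: "mps_represents n K r X x" and K: "1 \<le> K"
  shows "\<exists>Y w. mps_represents n K r Y x \<and> weight_compatible n K r ev w Y \<and>
    w 0 0 = 0 \<and> w K 0 = lam \<and> (\<forall>k\<le>K. \<forall>j<r k. w k j \<in> partial_eigs n K ev lam k)"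
proof -
  let ?N = "multi_indices n {1..K}"
  have r: "r 0 = 1" "r K = 1" using rep unfolding mps_represents_def is_mps_def by auto
  obtain b w where bw: "\<And>k. k \<le> K \<Longrightarrow> homogeneous_spanning n K r ev lam x k (b k) (w k)"
    using homogeneous_spanning_exists[OF supp nz rep K] by metis
  note bw = bw[unfolded homogeneous_spanning_def]
  have w_eig: "\<And>k j. k \<le> K \<Longrightarrow> j < r k \<Longrightarrow> w k j \<in> partial_eigs n K ev lam k"
    and homog: "\<And>k j \<alpha>. k \<le> K \<Longrightarrow> j < r k \<Longrightarrow> \<alpha> \<in> ?N \<Longrightarrow> b k j \<alpha> \<noteq> 0 \<Longrightarrow>
      (\<Sum>l=1..k. ev l (\<alpha> l)) = w k j"
    and column: "\<And>k j. k \<le> K \<Longrightarrow> j < r k \<Longrightarrow>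
      \<exists>s. \<exists>\<gamma>\<in>?N. \<forall>\<alpha>\<in>?N. b k j \<alpha> = s * x (glue k \<alpha> \<gamma>)"
    and span: "\<And>k \<gamma>. k \<le> K \<Longrightarrow> \<gamma> \<in> ?N \<Longrightarrow>
      \<exists>c. \<forall>\<alpha>\<in>?N. x (glue k \<alpha> \<gamma>) = (\<Sum>j<r k. c j * b k j \<alpha>)"
    and ends: "b 0 0 = (\<lambda>_. 1)" "w 0 0 = 0" "b K 0 = x" "w K 0 = lam"
    using bw by blast+
  have "\<exists>c. Suc k \<le> K \<and> \<beta> < n (Suc k) \<and> j < r (Suc k) \<longrightarrow>
    (\<forall>\<alpha>\<in>?N. \<alpha> (Suc k) = \<beta> \<longrightarrow> b (Suc k) j \<alpha> = (\<Sum>i<r k. c i * b k i \<alpha>))" for k \<beta> j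
  proof (cases "Suc k \<le> K \<and> \<beta> < n (Suc k) \<and> j < r (Suc k)")
    case True
    then have k: "Suc k \<le> K" and \<beta>: "\<beta> < n (Suc k)" and j: "j < r (Suc k)" by auto
    obtain s \<gamma> where \<gamma>: "\<gamma> \<in> ?N" "\<forall>\<alpha>\<in>?N. b (Suc k) j \<alpha> = s * x (glue (Suc k) \<alpha> \<gamma>)"
      using column[OF k j] by blast
    \<comment> \<open>Moving the index \<open>Suc k\<close>, now fixed, to the frozen part makes this a column one level below.\<close>
    have \<gamma>': "\<gamma>(Suc k := \<beta>) \<in> ?N"
      using \<gamma>(1) k \<beta> unfolding multi_indices_def PiE_iff extensional_def by auto
    then obtain c where c: "\<forall>\<alpha>\<in>?N. x (glue k \<alpha> (\<gamma>(Suc k := \<beta>))) = (\<Sum>i<r k. c i * b k i \<alpha>)"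
      using span[of k "\<gamma>(Suc k := \<beta>)"] k by auto
    have "glue (Suc k) \<alpha> \<gamma> = glue k \<alpha> (\<gamma>(Suc k := \<beta>))" if "\<alpha> (Suc k) = \<beta>" for \<alpha>
      using that by (auto simp: glue_def fun_eq_iff le_Suc_eq)
    then have "\<forall>\<alpha>\<in>?N. \<alpha> (Suc k) = \<beta> \<longrightarrow> b (Suc k) j \<alpha> = (\<Sum>i<r k. (s * c i) * b k i \<alpha>)"
      using \<gamma>(2) c by (simp add: sum_distrib_left mult.assoc)
    then show ?thesis by (intro exI[of _ "\<lambda>i. s * c i"] impI)
  qed blast
  then have "\<forall>k \<beta> j. \<exists>c. Suc k \<le> K \<and> \<beta> < n (Suc k) \<and> j < r (Suc k) \<longrightarrow>
    (\<forall>\<alpha>\<in>?N. \<alpha> (Suc k) = \<beta> \<longrightarrow> b (Suc k) j \<alpha> = (\<Sum>i<r k. c i * b k i \<alpha>))" by (intro allI)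
  then obtain c where c: "\<forall>k \<beta> j. Suc k \<le> K \<and> \<beta> < n (Suc k) \<and> j < r (Suc k) \<longrightarrow>
    (\<forall>\<alpha>\<in>?N. \<alpha> (Suc k) = \<beta> \<longrightarrow> b (Suc k) j \<alpha> = (\<Sum>i<r k. c k \<beta> j i * b k i \<alpha>))"
    unfolding choice_iff by (elim exE) (rule that)
  define Y where "Y k \<beta> = mat (r (k - 1)) (r k)
    (\<lambda>(i, j). if w (k - 1) i + ev k \<beta> = w k j then c (k - 1) \<beta> j i else 0)" for k \<beta>
  have mps: "is_mps n K r Y" unfolding is_mps_def Y_def using r by simp
  have block: "w k i + ev (Suc k) \<beta> = w (Suc k) j"
    if "i < r k" "j < r (Suc k)" "Y (Suc k) \<beta> $$ (i, j) \<noteq> 0" for k \<beta> i j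
    using that unfolding Y_def by (auto split: if_splits)
  have left: "core_prod r Y 0 k \<alpha> $$ (0, j) = b k j \<alpha>"
    if "\<alpha> \<in> ?N" "k \<le> K" "j < r k" for \<alpha> k j
    using that(2,3)
  proof (induction k arbitrary: j)
    case 0
    then show ?case using r ends by (simp add: core_prod_refl)
  next
    case (Suc k)
    let ?\<beta> = "\<alpha> (Suc k)"
    have lt: "\<alpha> l < n l" if "1 \<le> l" "l \<le> K" for l
      using multi_index_less[OF \<open>\<alpha> \<in> ?N\<close>] that by simp
    have C: "core_prod r Y 0 k \<alpha> \<in> carrier_mat 1 (r k)"
      using core_prod_carrier[OF mps, of 0 k \<alpha>] lt Suc r by simp
    have D: "Y (Suc k) ?\<beta> \<in> carrier_mat (r k) (r (Suc k))"
      using core_carrier[OF mps] lt Suc by simp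
    have entry: "core_prod r Y 0 (Suc k) \<alpha> $$ (0, j) = (\<Sum>i<r k. b k i \<alpha> * Y (Suc k) ?\<beta> $$ (i, j))"
      using mat_mult_entry[OF C D] Suc by (simp add: core_prod_Suc)
    show ?case
    proof (cases "(\<Sum>l=1..Suc k. ev l (\<alpha> l)) = w (Suc k) j")
      case True
      \<comment> \<open>At such \<open>\<alpha>\<close> the entries that were set to zero only meet vanishing \<open>b k i \<alpha>\<close>.\<close>
      have "b k i \<alpha> * Y (Suc k) ?\<beta> $$ (i, j) = c k ?\<beta> j i * b k i \<alpha>" if i: "i < r k" for i
      proof (cases "b k i \<alpha> = 0")
        case False
        then have "w k i + ev (Suc k) ?\<beta> = w (Suc k) j"
          using homog[of k i \<alpha>] i Suc \<open>\<alpha> \<in> ?N\<close> True by simp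
        then show ?thesis using i Suc unfolding Y_def by simp
      qed simp
      then have "core_prod r Y 0 (Suc k) \<alpha> $$ (0, j) = (\<Sum>i<r k. c k ?\<beta> j i * b k i \<alpha>)"
        unfolding entry by (intro sum.cong refl) simp
      then show ?thesis using c[rule_format, of k ?\<beta> j \<alpha>] Suc lt \<open>\<alpha> \<in> ?N\<close> by simp
    next
      case False
      \<comment> \<open>A nonzero term on the left would have the weights add up to \<open>w (Suc k) j\<close>.\<close>
      have "b k i \<alpha> * Y (Suc k) ?\<beta> $$ (i, j) = 0" if i: "i < r k" for i
        using homog[of k i \<alpha>] block[OF i \<open>j < r (Suc k)\<close>, of ?\<beta>] i Suc \<open>\<alpha> \<in> ?N\<close> False by fastforce
      then have "core_prod r Y 0 (Suc k) \<alpha> $$ (0, j) = 0"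
        unfolding entry by (intro sum.neutral ballI) simp
      moreover have "b (Suc k) j \<alpha> = 0"
        using homog[of "Suc k" j \<alpha>] Suc \<open>\<alpha> \<in> ?N\<close> False by blast
      ultimately show ?thesis by simp
    qed
  qed
  have "mps_represents n K r Y x"
    unfolding mps_represents_def tensor_eq_def mps_tensor_def using mps left ends r by simp
  moreover have "weight_compatible n K r ev w Y" unfolding weight_compatible_def using block by simp
  ultimately show ?thesis using ends(2,4) w_eig by (intro exI[of _ Y] exI[of _ w]) simp
qed

theorem theorem3p2:
  fixes K :: nat and n r :: "nat \<Rightarrow> nat"
    and ev :: "nat \<Rightarrow> nat \<Rightarrow> real" and lam :: real
    and x :: tensor and X :: cores
  assumes "1 \<le> K"
    and "\<And>k. k \<in> {1..K} \<Longrightarrow> 1 \<le> n k"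
    and "\<not> tensor_eq n {1..K} x (\<lambda>_. 0)"
    and "mps_represents n K r X x"
    and "mps_ranks_minimal n K r x"
  shows "tensor_eq n {1..K} (laplace_op n ev {1..K} x) (\<lambda>\<alpha>. lam * x \<alpha>) \<longleftrightarrow>
    (\<exists>Y. mps_represents n K r Y x \<and>
      (\<exists>S :: nat \<Rightarrow> real \<Rightarrow> nat set. S 0 0 = {0} \<and> S K lam = {0} \<and>
        (\<forall>k\<in>{1..K}.
          (\<forall>\<mu>\<in>partial_eigs n K ev lam k.
            S k \<mu> \<subseteq> {0..<r k} \<and>
            (\<forall>j\<in>S k \<mu>.
              tensor_eq n {1..k} (laplace_op n ev {1..k} (mps_left r Y k j))
                (\<lambda>\<alpha>. \<mu> * mps_left r Y k j \<alpha>) \<and>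
              tensor_eq n {k+1..K} (laplace_op n ev {k+1..K} (mps_right K r Y k j))
                (\<lambda>\<alpha>. (lam - \<mu>) * mps_right K r Y k j \<alpha>))) \<and>
          (\<forall>\<beta><n k. \<forall>i<r (k - 1). \<forall>j<r k. Y k \<beta> $$ (i, j) \<noteq> 0 \<longrightarrow>
            (\<exists>\<mu>\<in>partial_eigs n K ev lam (k - 1) \<inter> set_shift (partial_eigs n K ev lam k) (ev k \<beta>).
              i \<in> S (k - 1) \<mu> \<and> j \<in> S k (\<mu> + ev k \<beta>))))))" 
    (is "_ \<longleftrightarrow> ?adapted" is "_ \<longleftrightarrow> (\<exists>Y. _ \<and> (\<exists>S. _ \<and> _ \<and> (\<forall>k\<in>_. ?eigen Y S k \<and> ?blocks Y S k)))")
proof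
  assume eigen: "tensor_eq n {1..K} (laplace_op n ev {1..K} x) (\<lambda>\<alpha>. lam * x \<alpha>)"
  obtain \<alpha>0 where nz: "\<alpha>0 \<in> multi_indices n {1..K}" "x \<alpha>0 \<noteq> 0"
    using assms(3) unfolding tensor_eq_def by blast
  have supp: "\<forall>\<alpha>\<in>multi_indices n {1..K}. x \<alpha> \<noteq> 0 \<longrightarrow> (\<Sum>l=1..K. ev l (\<alpha> l)) = lam"
    using eigen laplace_eigen_iff_support[of "{1..K}" n ev x lam] by simp
  obtain Y w where rep: "mps_represents n K r Y x" and compat: "weight_compatible n K r ev w Y"
    and w_ends: "w 0 0 = 0" "w K 0 = lam"
    and w_eig: "\<forall>k\<le>K. \<forall>j<r k. w k j \<in> partial_eigs n K ev lam k"
    using homogeneous_cores[OF supp nz assms(4,1)] by blast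
  have mps: "is_mps n K r Y" and r: "r 0 = 1" "r K = 1"
    using rep unfolding mps_represents_def is_mps_def by auto
  define S where "S k \<mu> = {j. j < r k \<and> w k j = \<mu>}" for k \<mu>
  have partial_eigen:
    "tensor_eq n {1..k} (laplace_op n ev {1..k} (mps_left r Y k j)) (\<lambda>\<alpha>. \<mu> * mps_left r Y k j \<alpha>)"
    "tensor_eq n {k+1..K} (laplace_op n ev {k+1..K} (mps_right K r Y k j))
      (\<lambda>\<alpha>. (lam - \<mu>) * mps_right K r Y k j \<alpha>)"
    if k: "k \<in> {1..K}" and j: "j \<in> S k \<mu>" for k \<mu> j
  proof -
    have j: "j < r k" "w k j = \<mu>" using j unfolding S_def by auto
    have "(\<Sum>l=1..k. ev l (\<alpha> l)) = \<mu>"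
      if "\<alpha> \<in> multi_indices n {1..k}" "mps_left r Y k j \<alpha> \<noteq> 0" for \<alpha>
      using core_prod_weight[OF mps compat, of 0 k \<alpha> 0 j] that multi_index_less[OF that(1)] k j r w_ends
      unfolding mps_left_def by simp
    then show "tensor_eq n {1..k} (laplace_op n ev {1..k} (mps_left r Y k j))
      (\<lambda>\<alpha>. \<mu> * mps_left r Y k j \<alpha>)"
      by (simp add: laplace_eigen_iff_support)
    have "(\<Sum>l=k+1..K. ev l (\<alpha> l)) = lam - \<mu>"
      if "\<alpha> \<in> multi_indices n {k+1..K}" "mps_right K r Y k j \<alpha> \<noteq> 0" for \<alpha>
      using core_prod_weight[OF mps compat, of k K \<alpha> j 0] that multi_index_less[OF that(1)] k j r w_ends
      unfolding mps_right_def by simp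
    then show "tensor_eq n {k+1..K} (laplace_op n ev {k+1..K} (mps_right K r Y k j))
      (\<lambda>\<alpha>. (lam - \<mu>) * mps_right K r Y k j \<alpha>)"
      by (simp add: laplace_eigen_iff_support)
  qed
  have blocks: "\<exists>\<mu>\<in>partial_eigs n K ev lam (k - 1) \<inter> set_shift (partial_eigs n K ev lam k) (ev k \<beta>).
      i \<in> S (k - 1) \<mu> \<and> j \<in> S k (\<mu> + ev k \<beta>)"
    if k: "k \<in> {1..K}" and \<beta>: "\<beta> < n k" and i: "i < r (k - 1)" and j: "j < r k"
      and "Y k \<beta> $$ (i, j) \<noteq> 0" for k \<beta> i j
  proof -
    have "w (k - 1) i + ev k \<beta> = w k j"
      using weight_compatibleD[OF compat, of "k - 1" \<beta> i j] that by simp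
    then show ?thesis
      using w_eig k i j
      by (intro bexI[of _ "w (k - 1) i"]) (auto simp: S_def set_shift_def)
  qed
  have S: "S 0 0 = {0}" "S K lam = {0}" "\<And>k \<mu>. S k \<mu> \<subseteq> {0..<r k}"
    using w_ends r by (auto simp: S_def)
  show ?adapted
    by (intro exI[of _ Y] exI[of _ S] conjI ballI allI impI)
      (rule rep S partial_eigen blocks; assumption)+
next
  assume ?adapted
  then obtain Y S where rep: "mps_represents n K r Y x"
    and all: "\<forall>k\<in>{1..K}. ?eigen Y S k \<and> ?blocks Y S k" and SK: "S K lam = {0}"
    by (elim exE conjE) (rule that)
  have "K \<in> {1..K}" using assms(1) by simp
  note last = bspec[OF all this]
  obtain \<alpha>0 where nz: "\<alpha>0 \<in> multi_indices n {1..K}" "x \<alpha>0 \<noteq> 0"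
    using assms(3) unfolding tensor_eq_def by blast
  have mps: "is_mps n K r Y" and r: "r 0 = 1" "r K = 1"
    and x: "\<And>\<alpha>. \<alpha> \<in> multi_indices n {1..K} \<Longrightarrow> x \<alpha> = mps_left r Y K 0 \<alpha>"
    using rep unfolding mps_represents_def is_mps_def tensor_eq_def mps_tensor_def mps_left_def by auto
  obtain k where K: "K = Suc k" using assms(1) by (cases K) auto
  have lt: "\<alpha>0 l < n l" if "1 \<le> l" "l \<le> K" for l
    using multi_index_less[OF nz(1)] that by simp
  have C: "core_prod r Y 0 k \<alpha>0 \<in> carrier_mat 1 (r k)"
    using core_prod_carrier[OF mps, of 0 k \<alpha>0] lt r K by simp
  have D: "Y (Suc k) (\<alpha>0 (Suc k)) \<in> carrier_mat (r k) 1"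
    using core_carrier[OF mps, of k] lt r K by simp
  have "(\<Sum>i<r k. core_prod r Y 0 k \<alpha>0 $$ (0, i) * Y (Suc k) (\<alpha>0 (Suc k)) $$ (i, 0)) \<noteq> 0"
    using x[OF nz(1)] nz(2) mat_mult_entry[OF C D, of 0 0] K
    unfolding mps_left_def by (simp add: core_prod_Suc)
  \<comment> \<open>The block of a nonzero entry of the last core witnesses that \<open>lam\<close> occurs as a weight.\<close>
  then obtain i where i: "i < r k" "Y (Suc k) (\<alpha>0 (Suc k)) $$ (i, 0) \<noteq> 0"
    by (metis (no_types, lifting) lessThan_iff mult_eq_0_iff sum.neutral)
  have "\<exists>\<mu>\<in>partial_eigs n K ev lam (K - 1) \<inter> set_shift (partial_eigs n K ev lam K) (ev K (\<alpha>0 K)).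
      i \<in> S (K - 1) \<mu> \<and> 0 \<in> S K (\<mu> + ev K (\<alpha>0 K))"
    using conjunct2[OF last, rule_format, of "\<alpha>0 K" i 0] i lt assms(1) r K by simp
  then have "partial_eigs n K ev lam K \<noteq> {}" unfolding set_shift_def by blast
  then have lam: "lam \<in> partial_eigs n K ev lam K"
    using K unfolding partial_eigs_def eig_indices_def by auto
  have "tensor_eq n {1..K} (laplace_op n ev {1..K} (mps_left r Y K 0))
      (\<lambda>\<alpha>. lam * mps_left r Y K 0 \<alpha>)"
    by (rule conjunct1[OF bspec[OF conjunct2[OF bspec[OF conjunct1[OF last] lam]]]]) (simp add: SK)
  then show "tensor_eq n {1..K} (laplace_op n ev {1..K} x) (\<lambda>\<alpha>. lam * x \<alpha>)"
    using x by (simp add: laplace_eigen_iff_support)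
qed

end
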